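(* Let $0<\alpha_1,\alpha_2\leq 1$, $\theta=\frac{\alpha_2-\alpha_1}{\alpha_2+\alpha_1}$, $c=e^{\pi i\theta}$, and $G(z)=\left(\frac{1+cz}{1-z}\right)^{(\alpha_1+\alpha_2)/2}=1+\sum_{n\ge1}\lambda_n z^n$ on $\Delta$ (principal branch, $G(0)=1$), where $$\lambda_n=\sum_{k=1}^{n}\binom{n-1}{k-1}\binom{(\alpha_1+\alpha_2)/2}{k}(1+c)^k\quad(n\geq 1).$$ If $f\in\mathcal{S}^*_t(\alpha_1,\alpha_2)$, then $$\log\left\{\frac{f(z)}{z}\right\}\prec\widetilde{G}(z):=\int_0^z\frac{G(t)-1}{t}\,dt=\sum_{n=1}^\infty\frac{\lambda_n}{n}z^n,$$ and moreover $\widetilde{G}$ is convex univalent in $\Delta$.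
   Context: $\Delta=\{z\in\mathbb{C}:|z|<1\}$. $\mathcal{S}^*_t(\alpha_1,\alpha_2)$ denotes the class of functions $f$ analytic in $\Delta$ with $f(0)=0=f'(0)-1$ satisfying $-\frac{\pi\alpha_1}{2}<\arg\left\{\frac{zf'(z)}{f(z)}\right\}<\frac{\pi\alpha_2}{2}$ for all $z\in\Delta$. The branch of $\log(f(z)/z)$ is the one vanishing at $z=0$. For analytic $f,g$ in $\Delta$, $f\prec g$ means there is an analytic $w$ in $\Delta$ with $w(0)=0$, $|w(z)|<1$ and $f=g\circ w$. Convex univalent means univalent with image a convex domain. *)

theory Defs
  imports "HOL-Complex_Analysis.Complex_Analysis"
begin

text \<open>The class S*_t(alpha1, alpha2) of strongly starlike functions of order
 (alpha1, alpha2): normalized analytic f on the unit disc with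
 -pi alpha1/2 < arg (z f'(z)/f(z)) < pi alpha2/2. The quotient z f'(z)/f(z)
 must be defined (and nonzero, so that its argument makes sense); at z = 0 its
 value is the limit 1, so the condition is imposed for z <> 0.\<close>
definition Sstar_t :: "real \<Rightarrow> real \<Rightarrow> (complex \<Rightarrow> complex) set" where
  "Sstar_t a1 a2 = {f. f holomorphic_on ball 0 1 \<and> f 0 = 0 \<and> deriv f 0 = 1 \<and>
     (\<forall>z\<in>ball 0 1. z \<noteq> 0 \<longrightarrow>
        f z \<noteq> 0 \<and> z * deriv f z / f z \<noteq> 0 \<and>
        - (pi * a1 / 2) < Arg (z * deriv f z / f z) \<and>
        Arg (z * deriv f z / f z) < pi * a2 / 2)}"

definition subordinate :: "(complex \<Rightarrow> complex) \<Rightarrow> (complex \<Rightarrow> complex) \<Rightarrow> bool" where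
  "subordinate f g \<longleftrightarrow> (\<exists>w. w holomorphic_on ball 0 1 \<and> w 0 = 0 \<and>
      (\<forall>z\<in>ball 0 1. norm (w z) < 1) \<and> (\<forall>z\<in>ball 0 1. f z = g (w z)))"

definition convex_univalent :: "(complex \<Rightarrow> complex) \<Rightarrow> bool" where
  "convex_univalent g \<longleftrightarrow> inj_on g (ball 0 1) \<and> convex (g ` ball 0 1)"

definition theta :: "real \<Rightarrow> real \<Rightarrow> real" where
  "theta a1 a2 = (a2 - a1) / (a2 + a1)"

definition cc :: "real \<Rightarrow> real \<Rightarrow> complex" where
  "cc a1 a2 = exp (\<i> * of_real (pi * theta a1 a2))"

definition GG :: "real \<Rightarrow> real \<Rightarrow> complex \<Rightarrow> complex" where
  "GG a1 a2 z = ((1 + cc a1 a2 * z) / (1 - z)) powr of_real ((a1 + a2) / 2)"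

definition lam :: "real \<Rightarrow> real \<Rightarrow> nat \<Rightarrow> complex" where
  "lam a1 a2 n = (\<Sum>k=1..n. of_nat ((n - 1) choose (k - 1)) *
      of_real (((a1 + a2) / 2) gchoose k) * (1 + cc a1 a2) ^ k)"

definition Gtilde :: "real \<Rightarrow> real \<Rightarrow> complex \<Rightarrow> complex" where
  "Gtilde a1 a2 z = contour_integral (linepath 0 z) (\<lambda>t. (GG a1 a2 t - 1) / t)"

end

theory Submission
  imports Defs
begin

text \<open>
  Put h = G - 1, so that z * Gtilde'(z) = h(z), and h maps the disc univalently onto a translated
  sector, a convex set. For F with F(0) = 0 and z * F'(z) in the range of h, the function
  w = Gtilde^{-1} o F satisfies z * F' = (z * w' / w) * h(w). Where |w| is maximal on a closed disc,
  Jack's lemma makes the factor z * w' / w a real number k \<ge> 1, and starlikeness of h together with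
  the Schwarz lemma then forces |w(z)| \<le> |z|. Hence w never reaches the unit circle and F is
  subordinate to Gtilde. For F = L this is the subordination claim, as 1 + z * L' = z * f' / f; for
  F(z) = s * Gtilde(x * z) + t * Gtilde(z) with |x| \<le> 1 it shows that the image of Gtilde is convex.
  Univalence of Gtilde holds because its derivative takes values in a half-plane.
\<close>

section \<open>Jack's lemma and subordination\<close>

text \<open>Along the circle through \<open>z0\<close> the real part of \<open>w\<close> times
  \<open>cnj (w z0)\<close> is largest at \<open>z0\<close>, so its tangential derivative vanishes
  there and z0 w'(z0) / w(z0) is real. Along the radius the Schwarz lemma bounds |w(t z0)| by t
  |w(z0)|, and the radial derivative at t = 1 then shows that this number is at least 1.\<close>

lemma Jack_lemma:
  assumes holw: "w holomorphic_on ball 0 R" and w0: "w 0 = 0" and z0: "norm z0 < R"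
    and max: "\<And>z. norm z \<le> norm z0 \<Longrightarrow> norm (w z) \<le> norm (w z0)"
    and nz: "w z0 \<noteq> 0"
  shows "\<exists>k::real. k \<ge> 1 \<and> z0 * deriv w z0 = of_real k * w z0"
proof -
  have z0nz: "z0 \<noteq> 0"
    using nz w0 by auto
  have dw: "(w has_field_derivative deriv w z0) (at z0)"
    using holw z0 by (intro holomorphic_derivI[of w "ball 0 R"]) auto
  define q where "q = z0 * deriv w z0 / w z0"
  have q: "z0 * deriv w z0 = q * w z0"
    using nz by (simp add: q_def)
  have schwarz: "norm (w (of_real t * z0)) \<le> t * norm (w z0)" if "0 < t" "t < 1" for t :: real
  proof -
    define v where "v = (\<lambda>\<zeta>. w (\<zeta> * z0) / w z0)"
    have inb: "norm (\<zeta> * z0) < R" "norm (\<zeta> * z0) \<le> norm z0" if "norm \<zeta> < 1" for \<zeta>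
    proof -
      show "norm (\<zeta> * z0) \<le> norm z0"
        using that by (simp add: norm_mult mult_left_le_one_le)
      then show "norm (\<zeta> * z0) < R"
        using z0 by simp
    qed
    have "w \<circ> (\<lambda>\<zeta>. \<zeta> * z0) holomorphic_on ball 0 1"
      by (rule holomorphic_on_compose_gen[OF _ holw]) (use inb in \<open>auto intro!: holomorphic_intros\<close>)
    then have holv: "v holomorphic_on ball 0 1"
      unfolding v_def o_def using nz by (intro holomorphic_intros) auto
    have vle: "norm (v \<zeta>) \<le> 1" if "norm \<zeta> < 1" for \<zeta>
      using max[OF inb(2)[OF that]] nz by (simp add: v_def norm_divide)
    have v0: "v 0 = 0"
      by (simp add: v_def w0)
    \<comment> \<open>The Schwarz lemma asks for a strict bound. If |v| reached 1 inside, the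
      maximum principle would make \<open>v\<close> constant, hence equal to its value 0 at the
      origin.\<close>
    have vless: "norm (v \<zeta>) < 1" if "norm \<zeta> < 1" for \<zeta>
    proof (rule ccontr)
      assume "\<not> norm (v \<zeta>) < 1"
      then have eq: "norm (v \<zeta>) = 1"
        using vle[OF that] by simp
      have "v constant_on ball 0 1"
        by (rule maximum_modulus_principle[OF holv, of "ball 0 1" \<zeta>]) (use that eq vle in auto)
      then have "v \<zeta> = v 0"
        using that by (auto simp: constant_on_def)
      with eq v0 show False by simp
    qed
    have "norm (v (of_real t)) \<le> norm (of_real t :: complex)"
      by (rule Schwarz_Lemma(1)[OF holv v0 vless]) (use that in auto)
    then show ?thesis
      using nz that by (simp add: v_def norm_divide field_simps)
  qed
  define \<phi> where "\<phi> = (\<lambda>t::real. Re (w (cis t * z0) * cnj (w z0)))"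
  have cisd: "((\<lambda>t. cis t * z0) has_vector_derivative (\<i> * z0)) (at 0)"
  proof -
    have "((\<lambda>t. cis t * z0) has_vector_derivative (\<i> * cis 0 * z0)) (at 0)"
      unfolding cis_conv_exp
      by (rule has_vector_derivative_mult_left has_vector_derivative_real_field derivative_eq_intros refl | simp)+
    then show ?thesis by simp
  qed
  have "((w \<circ> (\<lambda>t. cis t * z0)) has_vector_derivative (\<i> * z0 * deriv w z0)) (at 0)"
    by (rule field_vector_diff_chain_at[OF cisd]) (use dw in simp)
  then have "((\<lambda>t. w (cis t * z0) * cnj (w z0)) has_vector_derivative
      (\<i> * z0 * deriv w z0) * cnj (w z0)) (at 0)"
    unfolding o_def by (rule has_vector_derivative_mult_left)
  then have "(\<phi> has_real_derivative Re (\<i> * z0 * deriv w z0 * cnj (w z0))) (at 0)"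
    unfolding \<phi>_def has_real_derivative_iff_has_vector_derivative
    by (rule bounded_linear.has_vector_derivative[OF bounded_linear_Re])
  moreover have "\<phi> t \<le> \<phi> 0" for t
  proof -
    have "\<phi> t \<le> norm (w (cis t * z0)) * norm (w z0)"
      unfolding \<phi>_def by (metis complex_Re_le_cmod complex_mod_cnj norm_mult)
    also have "\<dots> \<le> norm (w z0) * norm (w z0)"
      by (intro mult_right_mono max) (auto simp: norm_mult)
    also have "\<dots> = \<phi> 0"
      by (simp add: \<phi>_def cmod_power2 flip: power2_eq_square)
    finally show ?thesis .
  qed
  ultimately have "Re (\<i> * z0 * deriv w z0 * cnj (w z0)) = 0"
    by (intro DERIV_local_max[of \<phi> _ 0 1]) auto
  moreover have *: "z0 * deriv w z0 * cnj (w z0) = q * of_real ((norm (w z0))\<^sup>2)"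
    by (simp only: q mult.assoc complex_norm_square)
  ultimately have "Re (\<i> * (q * of_real ((norm (w z0))\<^sup>2))) = 0"
    by (metis mult.assoc)
  then have imq: "Im q = 0"
    using nz by simp
  \<comment> \<open>\<open>\<psi>\<close> vanishes at 1 and is at most 0 on (0, 1), so its
    derivative at 1, which is (Re q - 1) |w(z0)|^2, cannot be negative.\<close>
  define \<psi> where "\<psi> = (\<lambda>t::real. Re (w (of_real t * z0) * cnj (w z0)) - t * (norm (w z0))\<^sup>2)"
  have lind: "((\<lambda>t. of_real t * z0) has_vector_derivative z0) (at 1)"
    by (auto intro!: derivative_eq_intros simp: has_vector_derivative_def scaleR_conv_of_real)
  have "((w \<circ> (\<lambda>t. of_real t * z0)) has_vector_derivative (z0 * deriv w z0)) (at 1)"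
    by (rule field_vector_diff_chain_at[OF lind]) (use dw in simp)
  then have "((\<lambda>t. w (of_real t * z0) * cnj (w z0)) has_vector_derivative
      (z0 * deriv w z0) * cnj (w z0)) (at 1)"
    unfolding o_def by (rule has_vector_derivative_mult_left)
  then have "((\<lambda>t. Re (w (of_real t * z0) * cnj (w z0))) has_real_derivative
      Re (z0 * deriv w z0 * cnj (w z0))) (at 1)"
    unfolding has_real_derivative_iff_has_vector_derivative
    by (rule bounded_linear.has_vector_derivative[OF bounded_linear_Re])
  then have d\<psi>: "(\<psi> has_real_derivative (Re (z0 * deriv w z0 * cnj (w z0)) - (norm (w z0))\<^sup>2)) (at 1)"
    unfolding \<psi>_def by (rule DERIV_diff) (auto intro!: derivative_eq_intros)
  have "Re (z0 * deriv w z0 * cnj (w z0)) - (norm (w z0))\<^sup>2 \<ge> 0"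
  proof (rule ccontr)
    assume "\<not> ?thesis"
    then obtain d where d: "d > 0" "\<And>h. h > 0 \<Longrightarrow> h < d \<Longrightarrow> \<psi> 1 < \<psi> (1 - h)"
      using DERIV_neg_dec_left[OF d\<psi>] by auto
    define h where "h = min (d/2) (1/2)"
    have h: "0 < h" "h < d" "h < 1"
      using d(1) by (auto simp: h_def min_def)
    have "\<psi> 1 = 0"
      by (simp add: \<psi>_def cmod_power2) (simp add: power2_eq_square)
    moreover have "\<psi> (1 - h) \<le> 0"
    proof -
      have "Re (w (of_real (1 - h) * z0) * cnj (w z0)) \<le> norm (w (of_real (1 - h) * z0)) * norm (w z0)"
        by (metis complex_Re_le_cmod complex_mod_cnj norm_mult)
      also have "\<dots> \<le> (1 - h) * norm (w z0) * norm (w z0)"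
        by (intro mult_right_mono schwarz) (use h in auto)
      finally show ?thesis
        by (simp add: \<psi>_def power2_eq_square mult.assoc)
    qed
    ultimately show False
      using d(2)[OF h(1,2)] by simp
  qed
  then have "(Re q - 1) * (norm (w z0))\<^sup>2 \<ge> 0"
    unfolding * by (simp add: algebra_simps)
  then have "Re q \<ge> 1"
    using nz by (simp add: zero_le_mult_iff)
  moreover have "q = of_real (Re q)"
    using imq by (simp add: complex_eq_iff)
  ultimately show ?thesis
    using q by metis
qed

text \<open>The image is convex and contains 0, so scaling by 1/k maps it into itself. Pulled back
  through \<open>h\<close>, the scaling is a holomorphic self-map of the disc that fixes 0 and sends
  \<open>v\<close> to \<open>u\<close>, and the Schwarz lemma applies.\<close>

lemma starlike_norm_le:
  assumes holh: "h holomorphic_on ball 0 1" and inj: "inj_on h (ball 0 1)" and h0: "h 0 = 0"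
    and conv: "convex (h ` ball 0 1)"
    and k: "k \<ge> (1::real)" and u: "norm u < 1" and v: "norm v < 1"
    and eq: "of_real k * h u = h v"
  shows "norm u \<le> norm v"
proof -
  obtain hi where hi: "hi holomorphic_on h ` ball 0 1" "\<And>z. z \<in> ball 0 1 \<Longrightarrow> hi (h z) = z"
    using holomorphic_has_inverse[OF holh open_ball inj] by metis
  define \<omega> where "\<omega> = (\<lambda>z. hi (of_real (1/k) * h z))"
  have mem: "of_real (1/k) * h z \<in> h ` ball 0 1" if "z \<in> ball 0 1" for z
  proof -
    have "(1/k) *\<^sub>R h z + (1 - 1/k) *\<^sub>R h 0 \<in> h ` ball 0 1"
      by (rule convexD[OF conv]) (use that k in auto)
    then show ?thesis
      by (simp add: h0 scaleR_conv_of_real)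
  qed
  have "hi \<circ> (\<lambda>z. of_real (1/k) * h z) holomorphic_on ball 0 1"
    by (rule holomorphic_on_compose_gen[OF _ hi(1)]) (use mem holh in \<open>auto intro!: holomorphic_intros\<close>)
  then have hol: "\<omega> holomorphic_on ball 0 1"
    by (simp add: \<omega>_def o_def)
  have "hi (h 0) = 0"
    by (rule hi(2)) simp
  then have \<omega>0: "\<omega> 0 = 0"
    by (simp add: \<omega>_def h0)
  have less: "norm (\<omega> z) < 1" if "norm z < 1" for z
    using mem[of z] that hi(2) by (auto simp: \<omega>_def)
  have "of_real (1/k) * h v = h u"
    using eq k by (simp flip: eq add: field_simps)
  then have "\<omega> v = u"
    using hi(2)[of u] u by (simp add: \<omega>_def)
  then show ?thesis
    using Schwarz_Lemma(1)[OF hol \<omega>0 less v] by simp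
qed

text \<open>The pullback \<open>w\<close> is controlled only where \<open>F\<close> stays in the
  image of \<open>g\<close>. On any disc where this is so, Jack's lemma gives |w(z)| <= |z|. This
  bound keeps \<open>F\<close> inside the image of a compact disc, so there is no first radius at
  which \<open>F\<close> leaves the image of \<open>g\<close>.\<close>

lemma subordinate_convex_primitive:
  assumes holg: "g holomorphic_on ball 0 1" and injg: "inj_on g (ball 0 1)" and g0: "g 0 = 0"
    and h: "\<And>z. z \<in> ball 0 1 \<Longrightarrow> h z = z * deriv g z"
    and injh: "inj_on h (ball 0 1)" and conv: "convex (h ` ball 0 1)"
    and holF: "F holomorphic_on ball 0 1" and F0: "F 0 = 0"
    and F: "\<And>z. z \<in> ball 0 1 \<Longrightarrow> z * deriv F z \<in> h ` ball 0 1"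
  shows "subordinate F g"
proof -
  have h0: "h 0 = 0"
    using h[of 0] by simp
  have "(\<lambda>z. z * deriv g z) holomorphic_on ball 0 1"
    by (intro holomorphic_intros holg) auto
  then have holh: "h holomorphic_on ball 0 1"
    by (rule holomorphic_transform) (simp add: h)
  obtain hi where hi: "hi holomorphic_on h ` ball 0 1" "\<And>z. z \<in> ball 0 1 \<Longrightarrow> hi (h z) = z"
    using holomorphic_has_inverse[OF holh open_ball injh] by metis
  obtain gi where gi: "gi holomorphic_on g ` ball 0 1" "\<And>z. z \<in> ball 0 1 \<Longrightarrow> gi (g z) = z"
    using holomorphic_has_inverse[OF holg open_ball injg] by metis
  have opg: "open (g ` ball 0 1)"
    using open_mapping_thm3[OF holg open_ball injg] .
  \<comment> \<open>A second pullback, through \<open>h\<close> instead of \<open>g\<close>: it is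
    defined on the whole disc, and the Schwarz lemma gives it the bound by |z| that is later handed
    on to \<open>w\<close>.\<close>
  define \<omega> where "\<omega> = (\<lambda>z. hi (z * deriv F z))"
  have "hi \<circ> (\<lambda>z. z * deriv F z) holomorphic_on ball 0 1"
    by (rule holomorphic_on_compose_gen[OF _ hi(1)]) (use F holF in \<open>auto intro!: holomorphic_intros\<close>)
  then have hol\<omega>: "\<omega> holomorphic_on ball 0 1"
    by (simp add: \<omega>_def o_def)
  have h\<omega>: "norm (\<omega> z) < 1 \<and> h (\<omega> z) = z * deriv F z" if "norm z < 1" for z
    using F[of z] that hi(2) by (auto simp: \<omega>_def)
  have "hi (h 0) = 0"
    by (rule hi(2)) simp
  then have "\<omega> 0 = 0"
    by (simp add: \<omega>_def h0)
  then have \<omega>_le: "norm (\<omega> z) \<le> norm z" if "norm z < 1" for z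
    using Schwarz_Lemma(1)[OF hol\<omega> _ _ that] h\<omega> by blast
  define w where "w = (\<lambda>z. gi (F z))"
  have w0: "w 0 = 0"
    using gi(2)[of 0] by (simp add: w_def F0 g0)
  have holw: "w holomorphic_on ball 0 r" if "r \<le> 1" "F ` ball 0 r \<subseteq> g ` ball 0 1" for r
  proof -
    have "gi \<circ> F holomorphic_on ball 0 r"
      by (rule holomorphic_on_compose_gen[OF _ gi(1) that(2)])
         (rule holomorphic_on_subset[OF holF], use that in auto)
    then show ?thesis by (simp add: w_def o_def)
  qed
  have gw: "norm (w z) < 1 \<and> g (w z) = F z" if "F z \<in> g ` ball 0 1" for z
    using that gi(2) by (auto simp: w_def)
  have w_le: "norm (w z) \<le> norm z"
    if r: "r \<le> 1" and sub: "F ` ball 0 r \<subseteq> g ` ball 0 1" and z: "norm z < r" for r z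
  proof -
    note hw = holw[OF r sub]
    have "continuous_on (cball 0 (norm z)) (\<lambda>x. norm (w x))"
      by (intro continuous_intros holomorphic_on_imp_continuous_on holomorphic_on_subset[OF hw])
         (use z in auto)
    \<comment> \<open>Jack's lemma is applied where |w| is largest on the closed disc of radius |z|,
      not at \<open>z\<close> itself; a bound by |z0| there suffices since |z0| <= |z|.\<close>
    then obtain z0 where z0: "norm z0 \<le> norm z" "\<And>x. norm x \<le> norm z \<Longrightarrow> norm (w x) \<le> norm (w z0)"
      using continuous_attains_sup[of "cball 0 (norm z)" "\<lambda>x. norm (w x)"] by auto
    have z0r: "norm z0 < r" "norm z0 < 1"
      using z0 z r by auto
    have "norm (w z0) \<le> norm z0"
    proof (cases "w z0 = 0")
      case False
      obtain k :: real where k: "k \<ge> 1" "z0 * deriv w z0 = of_real k * w z0"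
        using Jack_lemma[OF hw w0 z0r(1) _ False] z0 by force
      have wz0: "norm (w z0) < 1" "g (w z0) = F z0"
        using gw[of z0] sub z0r by (auto simp: image_subset_iff)
      have "((g \<circ> w) has_field_derivative deriv g (w z0) * deriv w z0) (at z0)"
        by (rule DERIV_chain[OF holomorphic_derivI[OF holg] holomorphic_derivI[OF hw]]) (use z0r wz0 in auto)
      then have "(F has_field_derivative deriv g (w z0) * deriv w z0) (at z0)"
        by (rule has_field_derivative_transform_within_open[of _ _ _ "ball 0 r"])
           (use gw sub z0r in \<open>auto simp: image_subset_iff\<close>)
      then have "z0 * deriv F z0 = of_real k * h (w z0)"
        using wz0 k by (simp add: DERIV_imp_deriv h mult_ac)
      then have "of_real k * h (w z0) = h (\<omega> z0)"
        using h\<omega>[OF z0r(2)] by simp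
      then have "norm (w z0) \<le> norm (\<omega> z0)"
        using starlike_norm_le[OF holh injh h0 conv k(1)] wz0 h\<omega>[OF z0r(2)] by blast
      then show ?thesis
        using \<omega>_le[OF z0r(2)] by simp
    qed auto
    then show ?thesis
      using z0(1) z0(2)[of z] by simp
  qed
  have all: "F z \<in> g ` ball 0 1" if "z \<in> ball 0 1" for z
  proof (rule ccontr)
    assume notin: "F z \<notin> g ` ball 0 1"
    \<comment> \<open>The points of the closed disc at which \<open>F\<close> misses the image of
      \<open>g\<close>. This set is compact, so it has a point \<open>z0\<close> of least
      modulus.\<close>
    define K where "K = cball 0 (norm z) - (ball 0 1 \<inter> F -` (g ` ball 0 1))"
    have "open (ball 0 1 \<inter> F -` (g ` ball 0 1))"
      using continuous_open_preimage[OF holomorphic_on_imp_continuous_on[OF holF] open_ball opg] by simp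
    then have "compact K"
      unfolding K_def by (intro compact_diff compact_cball)
    moreover have "z \<in> K"
      using notin by (auto simp: K_def)
    ultimately obtain z0 where z0: "z0 \<in> K" "\<And>x. x \<in> K \<Longrightarrow> norm z0 \<le> norm x"
      using continuous_attains_inf[of K norm] continuous_on_norm_id by blast
    have z01: "norm z0 < 1"
      using z0 that by (auto simp: K_def)
    have nin: "F z0 \<notin> g ` ball 0 1"
      using z0(1) z01 by (auto simp: K_def)
    define r where "r = norm z0"
    have "F 0 \<in> g ` ball 0 1"
      using F0 g0 by (metis centre_in_ball imageI zero_less_one)
    then have rpos: "r > 0"
      using nin by (auto simp: r_def)
    have sub: "F ` ball 0 r \<subseteq> g ` ball 0 1"
    proof safe
      fix x assume "x \<in> ball (0::complex) r"
      then have "norm x < norm z0" by (simp add: r_def)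
      moreover have "norm z0 \<le> norm z"
        using z0(1) by (auto simp: K_def)
      ultimately show "F x \<in> g ` ball 0 1"
        using z0(2)[of x] z01 by (force simp: K_def)
    qed
    \<comment> \<open>The bound on \<open>w\<close> replaces the open image of \<open>g\<close> by
      the image of a closed disc. The latter is compact, hence closed, and so it also contains the
      boundary value \<open>F z0\<close>.\<close>
    have "F ` ball 0 r \<subseteq> g ` cball 0 r"
    proof safe
      fix x assume x: "x \<in> ball (0::complex) r"
      have "norm (w x) \<le> norm x"
        by (rule w_le[OF _ sub]) (use x z01 in \<open>auto simp: r_def\<close>)
      moreover have "g (w x) = F x"
        using gw sub x by blast
      ultimately show "F x \<in> g ` cball 0 r"
        using x by (intro image_eqI[of _ _ "w x"]) auto
    qed
    moreover have "closed (g ` cball 0 r)"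
      by (intro compact_imp_closed compact_continuous_image compact_cball
          holomorphic_on_imp_continuous_on holomorphic_on_subset[OF holg]) (use z01 in \<open>auto simp: r_def\<close>)
    moreover have "continuous_on (closure (ball 0 r)) F"
      using z01 rpos by (intro holomorphic_on_imp_continuous_on holomorphic_on_subset[OF holF]) (auto simp: r_def)
    ultimately have "F ` closure (ball 0 r) \<subseteq> g ` cball 0 r"
      by (intro image_closure_subset)
    then have "F z0 \<in> g ` cball 0 r"
      using rpos by (auto simp: r_def)
    with nin z01 show False
      by (auto simp: r_def)
  qed
  show ?thesis
    unfolding subordinate_def
    using holw[of 1] all gw w0 by (intro exI[of _ w]) force
qed

text \<open>If |u| <= |v| and u = x v, then s g(u) + t g(v) is the value at \<open>v\<close> of F(z)
  = s g(x z) + t g(z). Here z F'(z) = s h(x z) + t h(z) lies in the convex image of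
  \<open>h\<close>, so F is subordinate to \<open>g\<close> and \<open>g\<close> takes this
  value.\<close>

lemma convex_image_convex_primitive:
  assumes holg: "g holomorphic_on ball 0 1" and injg: "inj_on g (ball 0 1)" and g0: "g 0 = 0"
    and h: "\<And>z. z \<in> ball 0 1 \<Longrightarrow> h z = z * deriv g z"
    and injh: "inj_on h (ball 0 1)" and conv: "convex (h ` ball 0 1)"
  shows "convex (g ` ball 0 1)"
proof -
  have key: "s *\<^sub>R g u + t *\<^sub>R g v \<in> g ` ball 0 1"
    if st: "s \<ge> 0" "t \<ge> 0" "s + t = 1" and uv: "norm u \<le> norm v" "norm v < 1" for s t :: real and u v
  proof (cases "v = 0")
    case True
    then show ?thesis using that by (auto simp: g0 intro!: image_eqI[of _ _ 0])
  next
    case False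
    define x where "x = u / v"
    have x: "norm x \<le> 1" "x * v = u"
      using False uv by (auto simp: x_def norm_divide divide_le_eq)
    have xz: "norm (x * z) < 1" if "norm z < 1" for z
      by (metis mult_left_le_one_le norm_ge_zero norm_mult order_le_less_trans that x(1))
    define F where "F = (\<lambda>z. of_real s * g (x * z) + of_real t * g z)"
    have "g \<circ> (\<lambda>z. x * z) holomorphic_on ball 0 1"
      by (rule holomorphic_on_compose_gen[OF _ holg]) (use xz in \<open>auto intro!: holomorphic_intros\<close>)
    then have holF: "F holomorphic_on ball 0 1"
      unfolding F_def o_def using holg by (intro holomorphic_intros) auto
    have "z * deriv F z \<in> h ` ball 0 1" if z: "z \<in> ball 0 1" for z
    proof -
      have dg: "(g has_field_derivative deriv g y) (at y)" if "norm y < 1" for y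
        using holg that by (intro holomorphic_derivI[of g "ball 0 1"]) auto
      have "((\<lambda>z. g (x * z)) has_field_derivative deriv g (x * z) * x) (at z)"
        by (rule DERIV_chain'[OF _ dg]) (use xz z in \<open>auto intro!: derivative_eq_intros\<close>)
      then have "(F has_field_derivative of_real s * (deriv g (x * z) * x) + of_real t * deriv g z) (at z)"
        unfolding F_def by (intro DERIV_add DERIV_cmult dg) (use z in auto)
      then have "z * deriv F z = s *\<^sub>R h (x * z) + t *\<^sub>R h z"
        using h[of z] h[of "x * z"] xz[of z] z
        by (simp add: DERIV_imp_deriv scaleR_conv_of_real distrib_left mult_ac)
      also have "\<dots> \<in> h ` ball 0 1"
        by (rule convexD[OF conv]) (use xz z st in auto)
      finally show ?thesis .
    qed
    then have "subordinate F g"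
      by (intro subordinate_convex_primitive[OF holg injg g0 h injh conv holF]) (auto simp: F_def g0)
    then have "F v \<in> g ` ball 0 1"
      using uv by (force simp: subordinate_def)
    then show ?thesis
      using x by (simp add: F_def scaleR_conv_of_real)
  qed
  show ?thesis
  proof (rule convexI)
    fix p q and s t :: real
    assume "p \<in> g ` ball 0 1" "q \<in> g ` ball 0 1" and st: "0 \<le> s" "0 \<le> t" "s + t = 1"
    then obtain u v where uv: "p = g u" "q = g v" "norm u < 1" "norm v < 1"
      by auto
    show "s *\<^sub>R p + t *\<^sub>R q \<in> g ` ball 0 1"
      using key[of s t u v] key[of t s v u] uv st by (cases "norm u \<le> norm v") (auto simp: add.commute)
  qed
qed

text \<open>The Noshiro-Warschawski criterion. By the mean value theorem on the segment from x to y,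
  the real part of e times the difference quotient of \<open>g\<close> is a value of Re (e g'),
  hence not 0.\<close>

lemma Re_deriv_pos_imp_inj_on:
  assumes "convex S" and d: "\<And>z. z \<in> S \<Longrightarrow> (g has_field_derivative g' z) (at z)"
    and pos: "\<And>z. z \<in> S \<Longrightarrow> Re (e * g' z) > 0"
  shows "inj_on g S"
proof (rule inj_onI, rule ccontr)
  fix x y assume xy: "x \<in> S" "y \<in> S" "g x = g y" "x \<noteq> y"
  have sub: "closed_segment x y \<subseteq> S"
    using xy \<open>convex S\<close> by (simp add: closed_segment_subset)
  have "\<exists>u. u \<in> closed_segment x y \<and> Re (e * g y / (y - x)) - Re (e * g x / (y - x))
      = Re (e * g' u / (y - x) * (y - x))"
    by (rule complex_mvt_line) (use sub d xy in \<open>auto intro!: derivative_eq_intros\<close>)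
  then show False
    using xy sub pos by fastforce
qed

section \<open>Sectors and powers\<close>

text \<open>Concavity of the sine bounds the two sines on the right from below by u/(u+v) and
  v/(u+v) times the sine on the left. With the same weights, the powers r^v and r^(-u) have
  geometric mean 1, so by Young's inequality their arithmetic mean is at least 1.\<close>

lemma sin_add_le_weighted:
  fixes u v \<psi> r :: real
  assumes uv: "u \<ge> 0" "v \<ge> 0" "u + v > 0" and r: "r > 0" and \<psi>: "0 \<le> \<psi>" "(u + v) * \<psi> \<le> pi"
  shows "sin ((u + v) * \<psi>) \<le> r powr v * sin (u * \<psi>) + r powr (-u) * sin (v * \<psi>)"
proof -
  define T where "T = (u + v) * \<psi>"
  have T: "0 \<le> T" "T \<le> pi"
    using uv \<psi> by (auto simp: T_def)
  have conc: "concave_on {0..pi} sin"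
    by (rule f''_le0_imp_concave[where f' = cos and f'' = "\<lambda>x. - sin x"])
       (auto intro!: derivative_eq_intros sin_ge_zero)
  have sin_ge: "sin (p * T) \<ge> p * sin T" if "0 \<le> p" "p \<le> 1" for p
    using concave_onD[OF conc, of p 0 T] that T by simp
  define \<alpha> where "\<alpha> = u / (u + v)"
  define \<beta> where "\<beta> = v / (u + v)"
  have \<alpha>\<beta>: "0 \<le> \<alpha>" "0 \<le> \<beta>" "\<alpha> + \<beta> = 1" "\<alpha> * T = u * \<psi>" "\<beta> * T = v * \<psi>"
    using uv by (auto simp: \<alpha>_def \<beta>_def T_def simp flip: add_divide_distrib)
  have "v * \<alpha> + (-u) * \<beta> = 0"
    by (simp add: \<alpha>_def \<beta>_def)
  then have "1 = (r powr v) powr \<alpha> * (r powr (-u)) powr \<beta>"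
    using r by (simp add: powr_powr flip: powr_add)
  also have "\<dots> \<le> \<alpha> * r powr v + \<beta> * r powr (-u)"
    using r \<alpha>\<beta> by (intro Youngs_inequality_0) auto
  finally have "sin T \<le> (\<alpha> * r powr v + \<beta> * r powr (-u)) * sin T"
    using mult_right_mono[of 1 _ "sin T"] sin_ge_zero[OF T] by simp
  also have "\<dots> = r powr v * (\<alpha> * sin T) + r powr (-u) * (\<beta> * sin T)"
    by (simp add: algebra_simps)
  also have "\<dots> \<le> r powr v * sin (\<alpha> * T) + r powr (-u) * sin (\<beta> * T)"
    by (intro add_mono mult_left_mono sin_ge) (use \<alpha>\<beta> in auto)
  finally show ?thesis
    by (simp only: \<alpha>\<beta>(4,5) T_def[symmetric])
qed

text \<open>
  The quotient (m^b - 1) / (m - 1) lies in the cone spanned by 1 and 1 / m; this amounts to two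
  sine inequalities, for the weights (1 - b, b) and (b, 1).
\<close>

lemma powr_quotient_in_cone_upper:
  fixes m :: complex and b :: real
  assumes m: "Im m > 0" and b: "0 < b" "b \<le> 1"
  shows "\<exists>x y::real. x \<ge> 0 \<and> y \<ge> 0 \<and> x + y > 0 \<and>
    (m powr of_real b - 1) / (m - 1) = of_real x + of_real y / m"
proof -
  define r where "r = norm m"
  define \<psi> where "\<psi> = Arg m"
  define P where "P = r powr b"
  define q where "q = (m powr of_real b - 1) / (m - 1)"
  have nz: "m \<noteq> 0" "m \<noteq> 1"
    using m by auto
  have r: "r > 0"
    using nz by (simp add: r_def)
  have P: "P > 0"
    using r by (simp add: P_def)
  have \<psi>: "0 < \<psi>" "\<psi> < pi"
    using m Arg_lt_pi[of m] by (auto simp: \<psi>_def)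
  have mre: "m = of_real r * cis \<psi>"
    using rcis_cmod_Arg[of m] by (simp add: r_def \<psi>_def rcis_def)
  have pow: "m powr of_real b = of_real P * cis (b * \<psi>)"
  proof -
    have "Ln m = of_real (ln r) + \<i> * of_real \<psi>"
      using nz by (simp add: complex_eq_iff r_def \<psi>_def Arg_eq_Im_Ln)
    then have "m powr of_real b = exp (of_real (b * ln r)) * exp (\<i> * of_real (b * \<psi>))"
      using nz by (simp add: powr_def algebra_simps flip: exp_add)
    also have "\<dots> = of_real P * cis (b * \<psi>)"
      using r by (simp add: P_def powr_def cis_conv_exp flip: exp_of_real)
    finally show ?thesis .
  qed
  have sinb: "sin (b * \<psi>) > 0"
    using \<psi> b by (intro sin_gt_zero) (auto intro: order_le_less_trans[OF mult_left_le_one_le])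
  have sin\<psi>: "sin \<psi> > 0"
    using \<psi> by (intro sin_gt_zero) auto
  \<comment> \<open>The factor \<open>cnj (m - 1)\<close> makes the denominator real and positive,
    so the signs of Im q and Im (m q) can be read off the numerators.\<close>
  have qeq: "q = (m powr of_real b - 1) * cnj (m - 1) / of_real ((norm (m - 1))\<^sup>2)"
    unfolding q_def by (subst complex_div_cnj) simp
  have n1: "(norm (m - 1))\<^sup>2 > 0"
    using nz by simp
  have "Im ((m powr of_real b - 1) * cnj (m - 1)) = r * sin \<psi> - r * P * sin ((1 - b) * \<psi>) - P * sin (b * \<psi>)"
    by (subst pow, subst mre) (simp add: algebra_simps sin_diff)
  also have "\<dots> \<le> 0"
  proof -
    have "sin (((1 - b) + b) * \<psi>) \<le> r powr b * sin ((1 - b) * \<psi>) + r powr (-(1 - b)) * sin (b * \<psi>)"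
      by (rule sin_add_le_weighted) (use b r \<psi> in auto)
    then have "r * sin \<psi> \<le> r * (r powr b * sin ((1 - b) * \<psi>) + r powr (b - 1) * sin (b * \<psi>))"
      using r by (intro mult_left_mono) auto
    also have "\<dots> = r * P * sin ((1 - b) * \<psi>) + P * sin (b * \<psi>)"
      using r by (simp add: P_def powr_diff algebra_simps)
    finally show ?thesis by simp
  qed
  finally have imq: "Im q \<le> 0"
    unfolding qeq Im_divide_of_real using n1 by (intro divide_nonpos_pos) auto
  have "Im (m * ((m powr of_real b - 1) * cnj (m - 1)))
      = r * (r * P * sin (b * \<psi>) - P * sin ((b + 1) * \<psi>) + sin \<psi>)"
  proof -
    have "m * ((m powr of_real b - 1) * cnj (m - 1)) = (m powr of_real b - 1) * (of_real (r\<^sup>2) - m)"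
      unfolding r_def complex_norm_square by (simp add: algebra_simps)
    also have "Im \<dots> = r * (r * P * sin (b * \<psi>) - P * sin ((b + 1) * \<psi>) + sin \<psi>)"
      unfolding pow by (subst mre) (simp add: algebra_simps sin_add power2_eq_square)
    finally show ?thesis .
  qed
  also have "\<dots> \<ge> 0"
  proof -
    have "P * sin ((b + 1) * \<psi>) \<le> r * P * sin (b * \<psi>) + sin \<psi>"
    proof (cases "(b + 1) * \<psi> \<le> pi")
      case True
      have "sin ((b + 1) * \<psi>) \<le> r powr 1 * sin (b * \<psi>) + r powr (-b) * sin (1 * \<psi>)"
        by (rule sin_add_le_weighted) (use b r \<psi> True in auto)
      then have "P * sin ((b + 1) * \<psi>) \<le> P * (r powr 1 * sin (b * \<psi>) + r powr (-b) * sin (1 * \<psi>))"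
        using P by (intro mult_left_mono) auto
      also have "\<dots> = r * P * sin (b * \<psi>) + sin \<psi>"
        using r by (simp add: P_def powr_minus algebra_simps)
      finally show ?thesis .
    next
      case False
      have "(b + 1) * \<psi> \<le> 2 * \<psi>"
        using b \<psi> by (intro mult_right_mono) auto
      then have "sin ((b + 1) * \<psi>) \<le> 0"
        using False \<psi> by (intro sin_le_zero) linarith+
      then have "P * sin ((b + 1) * \<psi>) \<le> 0"
        using P by (simp add: mult_le_0_iff)
      also have "0 \<le> r * P * sin (b * \<psi>) + sin \<psi>"
        using r P sinb sin\<psi> by (intro add_nonneg_nonneg mult_nonneg_nonneg) auto
      finally show ?thesis .
    qed
    then show ?thesis
      using r by (intro mult_nonneg_nonneg) auto
  qed
  finally have immq: "Im (m * q) \<ge> 0"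
    unfolding qeq times_divide_eq_right Im_divide_of_real using n1 by (intro divide_nonneg_pos) auto
  \<comment> \<open>Found by solving q = x + y / m: the imaginary part of m q is x Im m, and since 1
    / m = cnj m / r^2, that of q is - y Im m / r^2.\<close>
  define x where "x = Im (m * q) / Im m"
  define y where "y = - (r\<^sup>2 * Im q / Im m)"
  have x: "x \<ge> 0"
    using immq m by (simp add: x_def)
  have y: "y \<ge> 0"
    using imq m r by (auto simp: y_def mult_le_0_iff divide_le_0_iff)
  have q: "q = of_real x + of_real y / m"
  proof -
    have "of_real y / m = of_real (y / r\<^sup>2) * cnj m"
      by (subst complex_div_cnj) (simp add: r_def)
    also have "y / r\<^sup>2 = - (Im q / Im m)"
      using r by (simp add: y_def)
    finally have "of_real x + of_real y / m = of_real x - of_real (Im q / Im m) * cnj m"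
      by simp
    also have "\<dots> = q"
      using m by (simp add: complex_eq_iff x_def field_simps)
    finally show ?thesis by simp
  qed
  \<comment> \<open>The power lies in the upper half-plane and so differs from 1; hence
    \<open>q\<close> is nonzero, which rules out x = y = 0.\<close>
  have "Im (m powr of_real b) > 0"
    using P sinb by (simp add: pow)
  then have "m powr of_real b - 1 \<noteq> 0"
    by auto
  then have "q \<noteq> 0"
    using nz by (simp add: q_def)
  then have "x + y > 0"
    using x y q by (cases "x = 0"; cases "y = 0") auto
  then show ?thesis
    using x y q unfolding q_def by blast
qed

text \<open>Conjugation reduces the lower half-plane to the upper one. On the positive axis the
  quotient is itself positive by monotonicity of the power, and y = 0 will do.\<close>

lemma powr_quotient_in_cone:
  fixes m :: complex and b :: real
  assumes m: "m \<notin> \<real>\<^sub>\<le>\<^sub>0" "m \<noteq> 1" and b: "0 < b" "b \<le> 1"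
  shows "\<exists>x y::real. x \<ge> 0 \<and> y \<ge> 0 \<and> x + y > 0 \<and>
    (m powr of_real b - 1) / (m - 1) = of_real x + of_real y / m"
proof -
  consider "Im m > 0" | "Im m < 0" | "Im m = 0" by linarith
  then show ?thesis
  proof cases
    case 1
    then show ?thesis using powr_quotient_in_cone_upper b by blast
  next
    case 2
    obtain x y :: real where xy: "x \<ge> 0" "y \<ge> 0" "x + y > 0"
      "(cnj m powr of_real b - 1) / (cnj m - 1) = of_real x + of_real y / cnj m"
      using powr_quotient_in_cone_upper[of "cnj m" b] 2 b by auto
    have "cnj ((m powr of_real b - 1) / (m - 1)) = cnj (of_real x + of_real y / m)"
      using xy(4) 2 by (simp add: cnj_powr)
    then have "(m powr of_real b - 1) / (m - 1) = of_real x + of_real y / m"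
      by (simp only: complex_cnj_cancel_iff)
    then show ?thesis using xy by blast
  next
    case 3
    define t where "t = Re m"
    have mt: "m = of_real t"
      using 3 by (simp add: t_def complex_eq_iff)
    have t: "t > 0" "t \<noteq> 1"
      using m by (auto simp: mt)
    have "(t powr b - 1) / (t - 1) > 0"
    proof (cases "t > 1")
      case True
      then show ?thesis using b by simp
    next
      case False
      then have "t powr b < 1"
        using t b powr_less_mono2[of b t 1] by simp
      then show ?thesis
        using False t by (simp add: divide_neg_neg)
    qed
    moreover have "m powr of_real b = of_real (t powr b)"
      using t by (simp add: mt powr_of_real)
    ultimately show ?thesis
      by (intro exI[of _ "(t powr b - 1) / (t - 1)"] exI[of _ 0]) (simp add: mt)
  qed
qed

text \<open>The edges are the rays at angles -A and B. As neither A nor B exceeds pi/2, the sector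
  is the intersection of the two half-planes on the inner sides of the lines through its
  edges.\<close>

lemma convex_sector:
  fixes A B :: real
  assumes "0 < A" "A \<le> pi/2" "0 < B" "B \<le> pi/2"
  shows "convex {w. w \<noteq> 0 \<and> - A < Arg w \<and> Arg w < B}"
proof -
  have im: "Im (w * cis s) = norm w * sin (Arg w + s)" for w s
  proof -
    have "w * cis s = rcis (norm w) (Arg w + s)"
      by (metis rcis_cmod_Arg rcis_mult cis_rcis_eq mult.right_neutral)
    then show ?thesis by simp
  qed
  have "{w. w \<noteq> 0 \<and> - A < Arg w \<and> Arg w < B} = {w. Im (w * cis A) > 0} \<inter> {w. Im (w * cis (-B)) < 0}"
    (is "?L = ?R")
  proof (intro equalityI subsetI)
    fix w assume w: "w \<in> ?L"
    then have "sin (Arg w + A) > 0" "sin (- (Arg w + (- B))) > 0"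
      using assms by (auto intro!: sin_gt_zero)
    then show "w \<in> ?R"
      unfolding sin_minus using w by (auto simp: im mult_less_0_iff simp del: times_complex.sel)
  next
    fix w assume "w \<in> ?R"
    then have s: "sin (Arg w + A) > 0" "sin (Arg w + (- B)) < 0" and w: "w \<noteq> 0"
      by (auto simp: im mult_less_0_iff zero_less_mult_iff simp del: times_complex.sel)
    \<comment> \<open>The principal argument lies in (-pi, pi], so each shifted angle stays in a
      range where the sign of its sine is known.\<close>
    have "- A < Arg w"
    proof (rule ccontr)
      assume "\<not> ?thesis"
      then have "sin (- (Arg w + A)) \<ge> 0"
        using assms mpi_less_Arg[of w] by (intro sin_ge_zero) auto
      with s show False by (simp only: sin_minus)
    qed
    moreover have "Arg w + A < pi"
    proof (rule ccontr)
      assume "\<not> ?thesis"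
      then have "sin (Arg w + A) \<le> 0"
        using assms Arg_le_pi[of w] by (intro sin_le_zero) auto
      with s show False by simp
    qed
    moreover have "Arg w < B"
    proof (rule ccontr)
      assume "\<not> ?thesis"
      then have "sin (Arg w + (- B)) \<ge> 0"
        using assms Arg_le_pi[of w] by (intro sin_ge_zero) auto
      with s show False by simp
    qed
    ultimately show "w \<in> ?L" using w by simp
  qed
  moreover have "convex {w. Im (w * cis A) > 0}" "convex {w. Im (w * cis (-B)) < 0}"
  proof -
    have lin: "linear (\<lambda>w. Im (w * cis s))" for s
      by (rule linearI) (auto simp: algebra_simps)
    have "{w. Im (w * cis A) > 0} = (\<lambda>w. Im (w * cis A)) -` {0<..}"
      "{w. Im (w * cis (-B)) < 0} = (\<lambda>w. Im (w * cis (-B))) -` {..<0}"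
      by auto
    then show "convex {w. Im (w * cis A) > 0}" "convex {w. Im (w * cis (-B)) < 0}"
      by (simp_all only: convex_linear_vimage[OF lin] convex_real_interval)
  qed
  ultimately show ?thesis
    by (simp only: convex_Int)
qed

section \<open>The functions G and Gtilde\<close>

text \<open>Half of the argument pi theta of c. Multiplication by
  \<open>cis (- halfangle a1 a2)\<close> turns the half-plane onto which \<open>mob\<close> maps the
  disc into the right half-plane.\<close>

definition halfangle :: "real \<Rightarrow> real \<Rightarrow> real" where
  "halfangle a1 a2 = pi * theta a1 a2 / 2"

definition mob :: "real \<Rightarrow> real \<Rightarrow> complex \<Rightarrow> complex" where
  "mob a1 a2 z = (1 + cc a1 a2 * z) / (1 - z)"

lemma GG_0: "GG a1 a2 0 = 1"
  by (simp add: GG_def)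

lemma deriv_GG_0: "deriv (GG a1 a2) 0 = of_real ((a1 + a2) / 2) * (1 + cc a1 a2)"
  unfolding GG_def
  by (rule DERIV_imp_deriv) (auto intro!: derivative_eq_intros simp: field_simps)

lemma Gtilde_0: "Gtilde a1 a2 0 = 0"
  by (simp add: Gtilde_def)

lemma GG_mob: "GG a1 a2 z = mob a1 a2 z powr of_real ((a1 + a2) / 2)"
  by (simp add: GG_def mob_def)

lemma cc_halfangle: "cc a1 a2 = cis (halfangle a1 a2) * cis (halfangle a1 a2)"
  unfolding cc_def cis_conv_exp[symmetric] by (simp add: halfangle_def cis_mult)

section \<open>Taylor expansion of G at 0\<close>

lemma gbinomial_complex_of_real: "complex_of_real x gchoose k = of_real (x gchoose k)"
  by (simp add: gbinomial_prod_rev)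

lemma Re_complex_mult_of_real_left: "Re (of_real x * w) = x * Re w"
  by simp

text \<open>The power is X^i (1 - X)^(-i), so its coefficient at n is that of (1 - X)^(-i) at n - i,
  a negative binomial coefficient. These are the inner binomials of \<open>lam\<close>.\<close>

lemma fps_X_over_one_minus_power_nth:
  assumes "0 < i" "i \<le> n"
  shows "((fps_X * inverse (1 - fps_X)) ^ i :: complex fps) $ n = of_nat ((n - 1) choose (i - 1))"
proof -
  have "((fps_X * inverse (1 - fps_X)) ^ i :: complex fps) $ n = inverse ((1 - fps_X) ^ i) $ (n - i)"
    using assms by (simp add: power_mult_distrib fps_X_power_mult_nth fps_inverse_power)
  also have "inverse ((1 - fps_X :: complex fps) ^ i) = fps_binomial (- of_nat i) oo (- fps_const 1 * fps_X)"
    using one_minus_fps_X_const_neg_power[of "1::complex" i] by simp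
  also have "- fps_const 1 * fps_X = (fps_const (- 1) * fps_X :: complex fps)"
    by simp
  also have "(fps_binomial (- of_nat i) oo (fps_const (- 1) * fps_X)) $ (n - i)
      = (- 1) ^ (n - i) * ((- of_nat i) gchoose (n - i) :: complex)"
    by (simp only: fps_compose_linear fps_nth_Abs_fps fps_binomial_nth)
  also have "\<dots> = (of_nat i + of_nat (n - i) - 1 :: complex) gchoose (n - i)"
    by (simp add: gbinomial_minus flip: mult.assoc power_add)
  also have "(of_nat i + of_nat (n - i) - 1 :: complex) = of_nat (n - 1)"
    using assms by (simp add: of_nat_diff)
  also have "(of_nat (n - 1) :: complex) gchoose (n - i) = of_nat ((n - 1) choose (n - i))"
    by (simp add: binomial_gbinomial)
  also have "(n - 1) choose (n - i) = (n - 1) choose (i - 1)"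
    using assms binomial_symmetric[of "i - 1" "n - 1"] by (simp add: Suc_le_eq)
  finally show ?thesis .
qed

text \<open>Since (1 + c z) / (1 - z) = 1 + (1 + c) z / (1 - z), G is a binomial series composed
  with (1 + c) X / (1 - X). The coefficient at 0 is set apart because \<open>lam\<close> at 0 is an
  empty sum, whereas G(0) = 1.\<close>

lemma GG_has_fps_expansion:
  "GG a1 a2 has_fps_expansion Abs_fps (\<lambda>n. if n = 0 then 1 else lam a1 a2 n)"
proof -
  define d where "d = 1 + cc a1 a2"
  define \<beta> where "\<beta> = complex_of_real ((a1 + a2) / 2)"
  define U where "U = (fps_const d * (fps_X * inverse (1 - fps_X)) :: complex fps)"
  have "(\<lambda>z. d * (z * inverse (1 - z))) has_fps_expansion U"
    unfolding U_def by (intro fps_expansion_intros) auto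
  then have "((\<lambda>x. (1 + x) powr \<beta>) \<circ> (\<lambda>z. d * (z * inverse (1 - z)))) has_fps_expansion (fps_binomial \<beta> oo U)"
    by (intro has_fps_expansion_compose has_fps_expansion_binomial_complex) (auto simp: U_def)
  moreover have "eventually (\<lambda>z. ((\<lambda>x. (1 + x) powr \<beta>) \<circ> (\<lambda>z. d * (z * inverse (1 - z)))) z = GG a1 a2 z) (nhds 0)"
  proof -
    have "eventually (\<lambda>z::complex. z \<noteq> 1) (nhds 0)"
      by (intro t1_space_nhds) simp
    then show ?thesis
    proof eventually_elim
      case (elim z)
      then have "1 + d * (z * inverse (1 - z)) = (1 + cc a1 a2 * z) / (1 - z)"
        by (simp add: d_def field_simps)
      then show ?case
        by (simp add: GG_def \<beta>_def)
    qed
  qed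
  ultimately have "GG a1 a2 has_fps_expansion (fps_binomial \<beta> oo U)"
    using has_fps_expansion_cong by blast
  moreover have "fps_binomial \<beta> oo U = Abs_fps (\<lambda>n. if n = 0 then 1 else lam a1 a2 n)"
  proof (rule fps_ext)
    fix n
    show "(fps_binomial \<beta> oo U) $ n = Abs_fps (\<lambda>n. if n = 0 then 1 else lam a1 a2 n) $ n"
    proof (cases "n = 0")
      case False
      have Ui: "(U ^ i) $ n = d ^ i * of_nat ((n - 1) choose (i - 1))" if "i \<in> {1..n}" for i
        using fps_X_over_one_minus_power_nth[of i n] that
        by (simp add: U_def power_mult_distrib[of "fps_const d"] fps_const_power)
      have "(fps_binomial \<beta> oo U) $ n = (\<Sum>i=0..n. (\<beta> gchoose i) * (U ^ i) $ n)"
        by (simp add: fps_compose_nth)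
      also have "\<dots> = (\<Sum>i=1..n. (\<beta> gchoose i) * (U ^ i) $ n)"
        using False by (simp add: sum.atLeast_Suc_atMost)
      also have "\<dots> = (\<Sum>i=1..n. of_nat ((n - 1) choose (i - 1)) * (\<beta> gchoose i) * d ^ i)"
        by (intro sum.cong refl) (simp add: Ui)
      also have "\<dots> = lam a1 a2 n"
        unfolding lam_def d_def \<beta>_def gbinomial_complex_of_real ..
      finally show ?thesis
        using False by simp
    qed simp
  qed
  ultimately show ?thesis by simp
qed

context
  fixes a1 a2 :: real
  assumes a: "0 < a1" "a1 \<le> 1" "0 < a2" "a2 \<le> 1"
begin

section \<open>The Moebius map of the disc onto a half-plane\<close>

lemma halfangle_bounds: "- (pi / 2) < halfangle a1 a2" "halfangle a1 a2 < pi / 2"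
  and cos_halfangle: "cos (halfangle a1 a2) > 0"
proof -
  have "- 1 < theta a1 a2" "theta a1 a2 < 1"
    using a by (auto simp: theta_def field_simps)
  then have "pi * (-1) < pi * theta a1 a2" "pi * theta a1 a2 < pi * 1"
    using pi_gt_zero by (metis mult_less_cancel_left_pos)+
  then show *: "- (pi / 2) < halfangle a1 a2" "halfangle a1 a2 < pi / 2"
    by (auto simp: halfangle_def)
  show "cos (halfangle a1 a2) > 0"
    using * by (intro cos_gt_zero_pi) auto
qed

text \<open>The reason for the choice of \<open>theta\<close>: the power (a1 + a2) / 2 takes the two
  edge directions of the half-plane to the edge directions of the sector.\<close>

lemma halfangle_sector:
  "(a1 + a2) / 2 * (halfangle a1 a2 + pi / 2) = pi * a2 / 2"
  "(a1 + a2) / 2 * (halfangle a1 a2 - pi / 2) = - (pi * a1 / 2)"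
  using a by (auto simp: halfangle_def theta_def field_simps)

text \<open>With E = \<open>cis (halfangle a1 a2)\<close> and c = E^2, the rotated value is (cnj E +
  E z) / (1 - z). After multiplication by \<open>cnj (1 - z)\<close> the numerator has real part Re
  E (1 - |z|^2), the other terms being purely imaginary in sum.\<close>

lemma mob_halfplane:
  assumes z: "norm z < 1"
  shows "Re (cis (- halfangle a1 a2) * mob a1 a2 z) > 0"
proof -
  define E where "E = cis (halfangle a1 a2)"
  have EE: "cnj E * E = 1"
    by (simp add: E_def cis_cnj cis_mult)
  have z1: "1 - z \<noteq> 0"
    using z by auto
  have "cis (- halfangle a1 a2) * mob a1 a2 z = cnj E * (1 + E * E * z) / (1 - z)"
    by (simp add: E_def cis_cnj mob_def cc_halfangle)
  also have "cnj E * (1 + E * E * z) = cnj E + E * z"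
    using EE by (simp add: distrib_left flip: mult.assoc)
  also have "(cnj E + E * z) / (1 - z) = (cnj E + E * z) * cnj (1 - z) / of_real ((norm (1 - z))\<^sup>2)"
    by (subst complex_div_cnj) simp
  finally have eq: "Re (cis (- halfangle a1 a2) * mob a1 a2 z)
      = Re ((cnj E + E * z) * cnj (1 - z)) / (norm (1 - z))\<^sup>2"
    by (simp only: Re_divide_of_real)
  have "Re ((cnj E + E * z) * cnj (1 - z)) = Re E * (1 - (norm z)\<^sup>2)"
    unfolding cmod_power2 by (simp add: algebra_simps power2_eq_square)
  also have "\<dots> > 0"
    using cos_halfangle z by (simp add: E_def power_less_one_iff abs_square_less_1)
  finally show ?thesis
    unfolding eq using z1 by simp
qed

text \<open>For E = \<open>cis (halfangle a1 a2)\<close> the rotated quantities are cnj E m + E and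
  cnj E + E / m. Here Re E > 0, and E / m = E cnj m / |m|^2 has a real part of the same sign as that
  of cnj E m.\<close>

lemma halfplane_plus_cc:
  assumes "Re (cis (- halfangle a1 a2) * m) > 0"
  shows "Re (cis (- halfangle a1 a2) * (m + cc a1 a2)) > 0"
    and "Re (cis (- halfangle a1 a2) * (m + cc a1 a2) / m) > 0"
proof -
  define E where "E = cis (halfangle a1 a2)"
  have c: "cis (- halfangle a1 a2) * cc a1 a2 = E"
    by (simp add: cc_halfangle E_def cis_mult flip: mult.assoc)
  show "Re (cis (- halfangle a1 a2) * (m + cc a1 a2)) > 0"
    unfolding distrib_left c using assms cos_halfangle by (simp add: E_def)
  have m: "m \<noteq> 0"
    using assms by auto
  have "cis (- halfangle a1 a2) * (m + cc a1 a2) / m = cnj E + E / m"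
    unfolding distrib_left c using m by (simp add: E_def cis_cnj add_divide_distrib)
  also have "E / m = E * cnj m / of_real ((norm m)\<^sup>2)"
    by (subst complex_div_cnj) simp
  also have "Re (cnj E + E * cnj m / of_real ((norm m)\<^sup>2)) = Re E + Re (E * cnj m) / (norm m)\<^sup>2"
    by (simp only: plus_complex.sel Re_divide_of_real cnj.sel)
  also have "Re (E * cnj m) = Re (cis (- halfangle a1 a2) * m)"
    by (simp add: E_def)
  finally show "Re (cis (- halfangle a1 a2) * (m + cc a1 a2) / m) > 0"
    using assms cos_halfangle m by (simp add: E_def add_pos_pos del: times_complex.sel)
qed

lemma one_plus_cc_nz: "1 + cc a1 a2 \<noteq> 0"
proof
  assume "1 + cc a1 a2 = 0"
  then have "Re (cis (- halfangle a1 a2) * (1 + cc a1 a2)) = 0"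
    by simp
  moreover have "Re (cis (- halfangle a1 a2) * 1) > 0"
    using cos_halfangle by simp
  ultimately show False
    using halfplane_plus_cc(1)[of 1] by simp
qed

lemma halfplane_Arg:
  assumes m: "Re (cis (- halfangle a1 a2) * m) > 0"
  shows "halfangle a1 a2 - pi / 2 < Arg m" "Arg m < halfangle a1 a2 + pi / 2" "m \<notin> \<real>\<^sub>\<le>\<^sub>0" "m \<noteq> 0"
proof -
  define n where "n = cis (- halfangle a1 a2) * m"
  have mn: "m = cis (halfangle a1 a2) * n"
    by (simp add: n_def cis_mult flip: mult.assoc)
  have n0: "n \<noteq> 0"
    using m by (auto simp: n_def)
  then have "\<bar>Arg n\<bar> < pi / 2"
    using m Re_Ln_pos_lt[of n] by (simp add: Arg_eq_Im_Ln flip: n_def)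
  with n0 have n: "n \<noteq> 0" "- (pi/2) < Arg n" "Arg n < pi/2"
    by auto
  have hb: "Arg (cis (halfangle a1 a2)) = halfangle a1 a2"
    using halfangle_bounds by (intro Arg_cis) auto
  \<comment> \<open>Both angles are smaller than pi/2 in modulus, so the arguments add without a
    jump.\<close>
  have "Arg m = halfangle a1 a2 + Arg n"
    unfolding mn using n hb halfangle_bounds by (subst Arg_times) auto
  then show b: "halfangle a1 a2 - pi / 2 < Arg m" "Arg m < halfangle a1 a2 + pi / 2"
    using n by auto
  show nz: "m \<noteq> 0"
    using m by auto
  have "Arg m \<noteq> pi"
    using b halfangle_bounds by auto
  then show "m \<notin> \<real>\<^sub>\<le>\<^sub>0"
    using nz Arg_eq_pi[of m] by (auto simp: complex_nonpos_Reals_iff less_le complex_eq_iff)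
qed

text \<open>The inverse Moebius map, which makes \<open>mob\<close> surjective onto the half-plane.
  Its values lie in the disc because |m + c|^2 - |m - 1|^2 = 4 Re E Re (cnj E m), with E =
  \<open>cis (halfangle a1 a2)\<close> and both real parts positive.\<close>

lemma mob_inverse:
  assumes m: "Re (cis (- halfangle a1 a2) * m) > 0"
  shows "norm ((m - 1) / (m + cc a1 a2)) < 1" "mob a1 a2 ((m - 1) / (m + cc a1 a2)) = m"
proof -
  define E where "E = cis (halfangle a1 a2)"
  have EE: "cnj E * E = 1"
    by (simp add: E_def cis_cnj cis_mult)
  have c: "cc a1 a2 = E * E"
    by (simp add: cc_halfangle E_def)
  have mc: "m + cc a1 a2 \<noteq> 0"
    using halfplane_plus_cc(1)[OF m] by (metis less_irrefl mult_zero_right zero_complex.sel(1))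
  have "cnj (E * E) * m + m = cnj E * cnj E * m + cnj E * E * m"
    by (simp add: EE)
  also have "\<dots> = (E + cnj E) * (cnj E * m)"
    by (simp add: algebra_simps)
  also have "\<dots> = of_real (2 * Re E) * (cnj E * m)"
    by (simp only: complex_add_cnj)
  finally have "Re (cnj (E * E) * m + m) = 2 * Re E * Re (cnj E * m)"
    by (simp only: Re_complex_mult_of_real_left)
  then have "Re (cnj (E * E) * m) + Re m = 2 * Re E * Re (cnj E * m)"
    by (simp only: plus_complex.sel)
  moreover have "norm (E * E) = 1"
    by (simp add: E_def norm_mult)
  moreover have "(norm (m + E * E))\<^sup>2 = (norm m)\<^sup>2 + (norm (E * E))\<^sup>2 + 2 * Re (cnj (E * E) * m)"
    by (simp only: cmod_power2) (simp add: algebra_simps power2_eq_square)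
  moreover have "(norm (m - 1))\<^sup>2 = (norm m)\<^sup>2 + 1 - 2 * Re m"
    unfolding cmod_power2 by (simp add: algebra_simps power2_eq_square)
  moreover have "2 * Re E * Re (cnj E * m) > 0"
    using m cos_halfangle by (intro mult_pos_pos) (auto simp: E_def)
  ultimately have "(norm (m - 1))\<^sup>2 < (norm (m + cc a1 a2))\<^sup>2"
    unfolding c by simp
  then have "norm (m - 1) < norm (m + cc a1 a2)"
    by (rule power_less_imp_less_base) simp
  then show "norm ((m - 1) / (m + cc a1 a2)) < 1"
    using mc by (simp add: norm_divide divide_less_eq)
  show "mob a1 a2 ((m - 1) / (m + cc a1 a2)) = m"
    using mc one_plus_cc_nz by (simp add: mob_def divide_simps) (simp add: algebra_simps)
qed

lemma mob_inj: "inj_on (mob a1 a2) (ball 0 1)"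
proof (rule inj_onI)
  fix x y assume xy: "x \<in> ball 0 1" "y \<in> ball 0 1" "mob a1 a2 x = mob a1 a2 y"
  have ne: "1 - x \<noteq> 0" "1 - y \<noteq> 0"
    using xy by auto
  have "(1 + cc a1 a2) * (x - y) = 0"
    using xy(3) ne by (simp add: mob_def field_simps)
  then show "x = y" using one_plus_cc_nz by simp
qed

section \<open>The power G and its image sector\<close>

lemma Ln_powr_halfplane:
  assumes m: "Re (cis (- halfangle a1 a2) * m) > 0" 
  shows "Ln (m powr of_real ((a1 + a2) / 2)) = of_real ((a1 + a2) / 2) * Ln m"
proof -
  define b where "b = (a1 + a2) / 2"
  have b: "0 < b" "b \<le> 1"
    using a by (auto simp: b_def)
  \<comment> \<open>As b <= 1, the argument stays inside (-pi, pi), so the logarithm of the power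
    needs no multiple of 2 pi as a correction.\<close>
  have *: "\<bar>b * Arg m\<bar> < pi"
    using b mult_left_le_one_le[of "\<bar>Arg m\<bar>" b] halfplane_Arg[OF m] halfangle_bounds
    by (auto simp: abs_mult)
  show ?thesis
    using * halfplane_Arg(4)[OF m] unfolding b_def[symmetric]
    by (simp add: powr_def Arg_eq_Im_Ln)
qed

lemma GG_image:
  "GG a1 a2 ` ball 0 1 = {w. w \<noteq> 0 \<and> - (pi * a1 / 2) < Arg w \<and> Arg w < pi * a2 / 2}" (is "_ = ?S")
  and GG_inj: "inj_on (GG a1 a2) (ball 0 1)"
proof -
  define b where "b = (a1 + a2) / 2"
  have b: "0 < b"
    using a by (auto simp: b_def)
  note hs = halfangle_sector[folded b_def]
  note lnp = Ln_powr_halfplane[folded b_def]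
  have GG: "GG a1 a2 z = mob a1 a2 z powr of_real b" for z
    by (simp add: GG_mob b_def)
  have "GG a1 a2 z \<in> ?S" if "norm z < 1" for z
  proof -
    note m = mob_halfplane[OF that]
    note am = halfplane_Arg[OF m]
    have nz: "GG a1 a2 z \<noteq> 0"
      using am by (simp add: GG)
    then have "Arg (GG a1 a2 z) = b * Arg (mob a1 a2 z)"
      using lnp[OF m] am by (simp add: GG Arg_eq_Im_Ln)
    moreover have "b * (halfangle a1 a2 - pi / 2) < b * Arg (mob a1 a2 z)"
      "b * Arg (mob a1 a2 z) < b * (halfangle a1 a2 + pi / 2)"
      using am b by (auto intro!: mult_strict_left_mono)
    ultimately show ?thesis
      using nz by (simp add: hs)
  qed
  moreover have "s \<in> GG a1 a2 ` ball 0 1" if s: "s \<in> ?S" for s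
  proof -
    \<comment> \<open>The value that \<open>mob\<close> has to take is the root s^(1/b), formed
      through the logarithm. The angle Arg s / b falls in the range of arguments of the half-plane,
      where \<open>Ln\<close> undoes \<open>exp\<close>.\<close>
    define m where "m = exp (Ln s / of_real b)"
    have im: "Im (Ln s / of_real b) = Arg s / b"
      using s by (simp add: Arg_eq_Im_Ln)
    have ar: "halfangle a1 a2 - pi / 2 < Arg s / b" "Arg s / b < halfangle a1 a2 + pi / 2"
      using s hs b by (auto simp: field_simps)
    have "cis (- halfangle a1 a2) * m = exp (Ln s / of_real b - \<i> * of_real (halfangle a1 a2))"
      by (simp add: m_def cis_conv_exp exp_diff exp_minus field_simps)
    then have "Re (cis (- halfangle a1 a2) * m) = exp (Re (Ln s / of_real b)) * cos (Arg s / b - halfangle a1 a2)"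
      using s by (simp add: Re_exp Arg_eq_Im_Ln)
    also have "\<dots> > 0"
      using ar by (intro mult_pos_pos cos_gt_zero_pi exp_gt_zero) linarith+
    finally have m: "Re (cis (- halfangle a1 a2) * m) > 0" .
    have "Ln m = Ln s / of_real b"
      unfolding m_def using im ar halfangle_bounds by (intro Ln_exp) auto
    then have "m powr of_real b = s"
      using s b by (simp add: powr_def m_def)
    then have "GG a1 a2 ((m - 1) / (m + cc a1 a2)) = s"
      using mob_inverse(2)[OF m] by (simp add: GG)
    then show ?thesis
      using mob_inverse(1)[OF m] by (intro image_eqI[of _ _ "(m - 1) / (m + cc a1 a2)"]) auto
  qed
  ultimately show "GG a1 a2 ` ball 0 1 = ?S"
    by auto
  show "inj_on (GG a1 a2) (ball 0 1)"
  proof (rule inj_onI)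
    fix x y assume xy: "x \<in> ball 0 1" "y \<in> ball 0 1" "GG a1 a2 x = GG a1 a2 y"
    have m: "Re (cis (- halfangle a1 a2) * mob a1 a2 x) > 0" "Re (cis (- halfangle a1 a2) * mob a1 a2 y) > 0"
      using xy mob_halfplane by auto
    have "of_real b * Ln (mob a1 a2 x) = of_real b * Ln (mob a1 a2 y)"
      using lnp[OF m(1)] lnp[OF m(2)] xy(3) by (simp only: GG)
    then have "Ln (mob a1 a2 x) = Ln (mob a1 a2 y)"
      using b by simp
    then have "mob a1 a2 x = mob a1 a2 y"
      using halfplane_Arg(4)[OF m(1)] halfplane_Arg(4)[OF m(2)] by (metis exp_Ln)
    then show "x = y"
      using mob_inj xy by (auto dest: inj_onD)
  qed
qed

section \<open>Holomorphy of G, the half-plane containing (G - 1) / z, and convexity of the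
  image\<close>

lemma GG_holomorphic: "GG a1 a2 holomorphic_on ball 0 1"
proof -
  have "mob a1 a2 holomorphic_on ball 0 1"
    unfolding mob_def by (intro holomorphic_intros) auto
  then show ?thesis
    unfolding GG_mob using halfplane_Arg(3)[OF mob_halfplane] by (intro holomorphic_intros) auto
qed

text \<open>
  With m = (1 + c * z) / (1 - z) one has 1 / z = (m + c) / (m - 1), so the claim reduces to the two
  extreme rays of the cone, i.e. to the factors m + c and (m + c) / m.
\<close>

lemma GG_quotient_Re_pos:
  assumes z: "norm z < 1" "z \<noteq> 0"
  shows "Re (cis (- halfangle a1 a2) * ((GG a1 a2 z - 1) / z)) > 0"
proof -
  define b where "b = (a1 + a2) / 2"
  define m where "m = mob a1 a2 z"
  define u where "u = cis (- halfangle a1 a2) * (m + cc a1 a2)"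
  have mh: "Re (cis (- halfangle a1 a2) * m) > 0"
    using mob_halfplane z by (simp add: m_def)
  have z1: "1 - z \<noteq> 0"
    using z by auto
  have m1: "m - 1 = (1 + cc a1 a2) * z / (1 - z)"
    using z1 by (simp add: m_def mob_def field_simps)
  have mc: "m + cc a1 a2 = (1 + cc a1 a2) / (1 - z)"
    using z1 by (simp add: m_def mob_def field_simps)
  have "m \<noteq> 1"
    using m1 one_plus_cc_nz z z1 by force
  then obtain x y :: real where xy: "x \<ge> 0" "y \<ge> 0" "x + y > 0"
    "(m powr of_real b - 1) / (m - 1) = of_real x + of_real y / m"
    using powr_quotient_in_cone[of m b] halfplane_Arg(3)[OF mh] a by (auto simp: b_def)
  have "(GG a1 a2 z - 1) / z = (m powr of_real b - 1) * (1 / z)"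
    by (simp add: GG_mob b_def m_def)
  also have "1 / z = (m + cc a1 a2) / (m - 1)"
    unfolding m1 mc using one_plus_cc_nz z1 z by simp
  finally have "(GG a1 a2 z - 1) / z = (m + cc a1 a2) * ((m powr of_real b - 1) / (m - 1))"
    by simp
  then have "cis (- halfangle a1 a2) * ((GG a1 a2 z - 1) / z) = u * (of_real x + of_real y / m)"
    by (simp only: xy(4) u_def mult.assoc)
  also have "\<dots> = of_real x * u + of_real y * (u / m)"
    by (simp add: algebra_simps)
  also have "Re \<dots> = x * Re u + y * Re (u / m)"
    by (simp only: plus_complex.sel Re_complex_mult_of_real_left)
  also have "\<dots> > 0"
  proof -
    have "Re u > 0" "Re (u / m) > 0"
      using halfplane_plus_cc[OF mh] by (simp_all add: u_def)
    then show ?thesis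
      using xy by (cases "x = 0") (auto intro!: add_pos_nonneg)
  qed
  finally show ?thesis .
qed

lemma convex_GG_image: "convex ((\<lambda>z. GG a1 a2 z - 1) ` ball 0 1)"
proof -
  have "convex (GG a1 a2 ` ball 0 1)"
    unfolding GG_image by (rule convex_sector) (use a in auto)
  then have "convex ((\<lambda>w. - 1 + w) ` (GG a1 a2 ` ball 0 1))"
    by (rule convex_translation)
  then show ?thesis
    by (simp add: image_image)
qed

section \<open>Gtilde as a univalent and convex primitive of (G - 1) / z\<close>

lemma Gtilde_derivative:
  obtains k where "\<And>z. z \<in> ball 0 1 \<Longrightarrow> (Gtilde a1 a2 has_field_derivative k z) (at z)"
    "\<And>z. z \<in> ball 0 1 \<Longrightarrow> GG a1 a2 z - 1 = z * k z" "k 0 = deriv (GG a1 a2) 0"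
proof -
  have hol: "(\<lambda>z. GG a1 a2 z - 1) holomorphic_on ball 0 1"
    by (intro holomorphic_intros GG_holomorphic)
  \<comment> \<open>\<open>k\<close> is (G - 1) / z with its removable singularity filled in, the
    value at 0 being G'(0).\<close>
  obtain k where k: "k holomorphic_on ball 0 1" "\<And>z. norm z < 1 \<Longrightarrow> GG a1 a2 z - 1 = z * k z"
    "deriv (\<lambda>z. GG a1 a2 z - 1) 0 = k 0"
    using Schwarz3[OF hol] GG_0 by auto
  have "GG a1 a2 field_differentiable at 0"
    using GG_holomorphic by (auto simp: holomorphic_on_open field_differentiable_def)
  then have k0: "k 0 = deriv (GG a1 a2) 0"
    using k(3) by simp
  obtain g where g: "\<And>x. x \<in> ball 0 1 \<Longrightarrow> (g has_field_derivative k x) (at x within ball 0 1)"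
    using holomorphic_convex_primitive'[OF convex_ball open_ball k(1)] by auto
  have Gt: "Gtilde a1 a2 z = g z - g 0" if z: "z \<in> ball 0 1" for z
  proof -
    have "closed_segment 0 z \<subseteq> ball 0 1"
      using z by (intro closed_segment_subset) auto
    then have "(k has_contour_integral (g (pathfinish (linepath 0 z)) - g (pathstart (linepath 0 z)))) (linepath 0 z)"
      by (intro contour_integral_primitive[OF g]) auto
    then have "((\<lambda>x. k (linepath 0 z x) * (z - 0)) has_integral (g z - g 0)) {0..1}"
      by (simp add: has_contour_integral_linepath)
    note int = this
    \<comment> \<open>At x = 0 the path is at the origin, where the quotient in
      \<open>Gtilde\<close> has the value 0 by the convention on division and not G'(0). A single
      parameter value does not affect the integral.\<close>
    have eq: "(GG a1 a2 (linepath 0 z x) - 1) / linepath 0 z x * (z - 0) = k (linepath 0 z x) * (z - 0)"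
      if "x \<in> {0..1} - {0}" for x
    proof (cases "z = 0")
      case False
      have "linepath 0 z x \<in> ball 0 1"
        using \<open>closed_segment 0 z \<subseteq> ball 0 1\<close> that linepath_in_path[of x 0 z] by auto
      moreover have "linepath 0 z x \<noteq> 0"
        using False that by (simp add: linepath_def)
      ultimately show ?thesis
        using k(2)[of "linepath 0 z x"] by (simp del: linepath_0)
    qed simp
    have "((\<lambda>x. (GG a1 a2 (linepath 0 z x) - 1) / linepath 0 z x * (z - 0)) has_integral (g z - g 0)) {0..1}"
      by (rule has_integral_spike_finite[of "{0}", OF _ eq int]) simp
    then show ?thesis
      unfolding Gtilde_def by (intro contour_integral_unique) (simp add: has_contour_integral_linepath)
  qed
  have "(Gtilde a1 a2 has_field_derivative k z) (at z)" if "z \<in> ball 0 1" for z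
  proof -
    have "((\<lambda>z. g z - g 0) has_field_derivative k z) (at z)"
      using g[OF that] at_within_open[OF that open_ball] by (auto intro!: derivative_eq_intros)
    then show ?thesis
      by (rule has_field_derivative_transform_within_open[OF _ open_ball that]) (simp add: Gt)
  qed
  then show ?thesis
    using that k(2) k0 by auto
qed

lemma Gtilde_holomorphic: "Gtilde a1 a2 holomorphic_on ball 0 1"
proof -
  obtain k where "\<And>z. z \<in> ball 0 1 \<Longrightarrow> (Gtilde a1 a2 has_field_derivative k z) (at z)"
    by (rule Gtilde_derivative) blast
  then show ?thesis
    unfolding holomorphic_on_open[OF open_ball] by blast
qed

lemma deriv_Gtilde:
  assumes "z \<in> ball 0 1"
  shows "GG a1 a2 z - 1 = z * deriv (Gtilde a1 a2) z"
proof -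
  obtain k where k: "\<And>z. z \<in> ball 0 1 \<Longrightarrow> (Gtilde a1 a2 has_field_derivative k z) (at z)"
    "\<And>z. z \<in> ball 0 1 \<Longrightarrow> GG a1 a2 z - 1 = z * k z"
    by (rule Gtilde_derivative) blast
  show ?thesis
    using k(2)[OF assms] DERIV_imp_deriv[OF k(1)[OF assms]] by simp
qed

text \<open>The derivative, rotated by \<open>cis (- halfangle a1 a2)\<close>, has positive real
  part: away from 0 it is (G - 1) / z, and at 0 it is (a1 + a2) / 2 times 1 + c.\<close>

lemma Gtilde_inj: "inj_on (Gtilde a1 a2) (ball 0 1)"
proof -
  obtain k where k: "\<And>z. z \<in> ball 0 1 \<Longrightarrow> (Gtilde a1 a2 has_field_derivative k z) (at z)"
    "\<And>z. z \<in> ball 0 1 \<Longrightarrow> GG a1 a2 z - 1 = z * k z" "k 0 = deriv (GG a1 a2) 0"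
    by (rule Gtilde_derivative) blast
  have "Re (cis (- halfangle a1 a2) * k z) > 0" if "z \<in> ball 0 1" for z
  proof (cases "z = 0")
    case True
    have "cis (- halfangle a1 a2) * k z = of_real ((a1 + a2) / 2) * (cis (- halfangle a1 a2) * (1 + cc a1 a2))"
      using k(3) True by (simp add: deriv_GG_0 mult_ac)
    moreover have "Re (cis (- halfangle a1 a2) * (1 + cc a1 a2)) > 0"
      by (rule halfplane_plus_cc(1)) (use cos_halfangle in simp)
    ultimately show ?thesis
      using a by (simp only: Re_complex_mult_of_real_left) (simp del: times_complex.sel)
  next
    case False
    then have "k z = (GG a1 a2 z - 1) / z"
      using k(2)[OF that] by simp
    then show ?thesis
      using GG_quotient_Re_pos[of z] that False by simp
  qed
  then show ?thesis
    by (rule Re_deriv_pos_imp_inj_on[OF convex_ball k(1), rotated])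
qed

lemma convex_univalent_Gtilde: "convex_univalent (Gtilde a1 a2)"
  and subordinate_GtildeI: "\<And>F. F holomorphic_on ball 0 1 \<Longrightarrow> F 0 = 0 \<Longrightarrow>
    (\<And>z. z \<in> ball 0 1 \<Longrightarrow> z * deriv F z + 1 \<in> GG a1 a2 ` ball 0 1) \<Longrightarrow> subordinate F (Gtilde a1 a2)"
proof -
  have inj: "inj_on (\<lambda>z. GG a1 a2 z - 1) (ball 0 1)"
    using GG_inj by (auto simp: inj_on_def)
  note * = Gtilde_holomorphic Gtilde_inj Gtilde_0 deriv_Gtilde inj convex_GG_image
  show "convex_univalent (Gtilde a1 a2)"
    unfolding convex_univalent_def using convex_image_convex_primitive[OF *] Gtilde_inj by blast
  show "subordinate F (Gtilde a1 a2)" if "F holomorphic_on ball 0 1" "F 0 = 0"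
    and F: "\<And>z. z \<in> ball 0 1 \<Longrightarrow> z * deriv F z + 1 \<in> GG a1 a2 ` ball 0 1" for F
  proof (rule subordinate_convex_primitive[OF * that(1,2)])
    fix z :: complex assume "z \<in> ball 0 1"
    then obtain y where "y \<in> ball 0 1" "z * deriv F z + 1 = GG a1 a2 y"
      using F by blast
    then show "z * deriv F z \<in> (\<lambda>z. GG a1 a2 z - 1) ` ball 0 1"
      by (intro image_eqI[of _ _ y]) (simp_all add: eq_diff_eq)
  qed
qed

section \<open>Power series of G and Gtilde on the disc\<close>

lemma GG_sums:
  assumes "z \<in> ball 0 1"
  shows "(\<lambda>n. lam a1 a2 (Suc n) * z ^ Suc n) sums (GG a1 a2 z - 1)"
proof -
  have "(\<lambda>n. Abs_fps (\<lambda>n. if n = 0 then 1 else lam a1 a2 n) $ n * z ^ n) sums GG a1 a2 z"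
    by (rule has_fps_expansion_imp_sums_complex[OF GG_has_fps_expansion, where r = 1])
       (use GG_holomorphic assms in \<open>auto simp: one_ereal_def\<close>)
  then show ?thesis
    using sums_split_initial_segment[of
        "\<lambda>n. Abs_fps (\<lambda>n. if n = 0 then 1 else lam a1 a2 n) $ n * z ^ n" _ 1] by simp
qed

text \<open>Comparing coefficients in z Gtilde'(z) = G(z) - 1 shows that n times the n-th Taylor
  coefficient of Gtilde is \<open>lam a1 a2 n\<close> for n >= 1. Holomorphy on the disc makes the
  Taylor series converge in all of it.\<close>

lemma Gtilde_sums:
  assumes "z \<in> ball 0 1"
  shows "(\<lambda>n. lam a1 a2 (Suc n) / of_nat (Suc n) * z ^ Suc n) sums Gtilde a1 a2 z"
proof -
  define F where "F = fps_expansion (Gtilde a1 a2) 0"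
  have F: "Gtilde a1 a2 has_fps_expansion F"
    unfolding F_def by (rule has_fps_expansion_fps_expansion[OF open_ball _ Gtilde_holomorphic]) simp
  have "(\<lambda>z. z * deriv (Gtilde a1 a2) z) has_fps_expansion fps_X * fps_deriv F"
    by (intro fps_expansion_intros F)
  moreover have "eventually (\<lambda>z. z * deriv (Gtilde a1 a2) z = GG a1 a2 z - 1) (nhds 0)"
    using eventually_nhds_in_open[of "ball 0 1" "0::complex"]
    by (rule eventually_mono) (use deriv_Gtilde in auto)
  ultimately have "(\<lambda>z. GG a1 a2 z - 1) has_fps_expansion fps_X * fps_deriv F"
    by (simp only: has_fps_expansion_cong[OF _ refl])
  moreover have "(\<lambda>z. GG a1 a2 z - 1) has_fps_expansion Abs_fps (\<lambda>n. if n = 0 then 1 else lam a1 a2 n) - 1"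
    by (intro fps_expansion_intros GG_has_fps_expansion)
  ultimately have "fps_X * fps_deriv F = Abs_fps (\<lambda>n. if n = 0 then 1 else lam a1 a2 n) - 1"
    by (metis fps_expansion_eqI)
  then have "(fps_X * fps_deriv F) $ Suc n = lam a1 a2 (Suc n)" for n
    by simp
  then have nth: "F $ Suc n = lam a1 a2 (Suc n) / of_nat (Suc n)" for n
    by (simp add: field_simps del: of_nat_Suc)
  have F0: "F $ 0 = 0"
    using has_fps_expansion_imp_0_eq_fps_nth_0[OF F] Gtilde_0 by simp
  have "(\<lambda>n. F $ n * z ^ n) sums Gtilde a1 a2 z"
    by (rule has_fps_expansion_imp_sums_complex[OF F, where r = 1])
       (use Gtilde_holomorphic assms in \<open>auto simp: one_ereal_def\<close>)
  then show ?thesis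
    using sums_split_initial_segment[of "\<lambda>n. F $ n * z ^ n" _ 1] by (simp add: F0 nth del: of_nat_Suc)
qed

end

text \<open>The logarithmic derivative of f(z) = z exp (L(z)). This identity holds at 0 too, where
  both sides vanish, so it is valid on the whole disc and can be differentiated.\<close>

lemma Sstar_t_log_derivative:
  assumes f: "f \<in> Sstar_t a1 a2" and L: "L holomorphic_on ball 0 1"
    and expL: "\<forall>z\<in>ball 0 1. z \<noteq> 0 \<longrightarrow> exp (L z) = f z / z"
    and z: "z \<in> ball 0 1" "z \<noteq> 0"
  shows "z * deriv L z + 1 = z * deriv f z / f z"
proof -
  have f0: "f 0 = 0"
    using f by (simp add: Sstar_t_def)
  have "((\<lambda>x. x * exp (L x)) has_field_derivative exp (L z) + z * (exp (L z) * deriv L z)) (at z)"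
    using holomorphic_derivI[OF L open_ball z(1)] by (auto intro!: derivative_eq_intros)
  then have "(f has_field_derivative exp (L z) + z * (exp (L z) * deriv L z)) (at z)"
  proof (rule has_field_derivative_transform_within_open[OF _ open_ball z(1)])
    show "x * exp (L x) = f x" if "x \<in> ball 0 1" for x
      using expL f0 that by (cases "x = 0") auto
  qed
  then have "deriv f z = exp (L z) * (z * deriv L z + 1)"
    by (simp add: DERIV_imp_deriv algebra_simps)
  moreover have "f z = z * exp (L z)"
    using expL z by simp
  ultimately show ?thesis
    using z by simp
qed

theorem theorem2p2:
  fixes a1 a2 :: real and f L :: "complex \<Rightarrow> complex"
  assumes "0 < a1" "a1 \<le> 1" "0 < a2" "a2 \<le> 1"
    and "f \<in> Sstar_t a1 a2"
    and "L holomorphic_on ball 0 1" "L 0 = 0"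
    and "\<forall>z\<in>ball 0 1. z \<noteq> 0 \<longrightarrow> exp (L z) = f z / z"
  shows "(\<forall>z\<in>ball 0 1. (\<lambda>n. lam a1 a2 (Suc n) * z ^ Suc n) sums (GG a1 a2 z - 1))
    \<and> (\<forall>z\<in>ball 0 1. (\<lambda>n. lam a1 a2 (Suc n) / of_nat (Suc n) * z ^ Suc n) sums Gtilde a1 a2 z)
    \<and> subordinate L (Gtilde a1 a2)
    \<and> convex_univalent (Gtilde a1 a2)"
proof -
  note a = assms(1-4)
  \<comment> \<open>The sector condition on z f' / f says that z L' + 1 takes its values in the
    image of G. At z = 0 the value is 1 = G(0).\<close>
  have "z * deriv L z + 1 \<in> GG a1 a2 ` ball 0 1" if z: "z \<in> ball 0 1" for z
  proof (cases "z = 0")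
    case True
    then show ?thesis
      using GG_0[of a1 a2] by (auto intro!: image_eqI[of _ _ 0])
  next
    case False
    then show ?thesis
      using assms(5) z Sstar_t_log_derivative[OF assms(5,6,8) z False]
      by (simp add: GG_image[OF a] Sstar_t_def)
  qed
  then have "subordinate L (Gtilde a1 a2)"
    by (intro subordinate_GtildeI[OF a] assms)
  then show ?thesis
    using GG_sums[OF a] Gtilde_sums[OF a] convex_univalent_Gtilde[OF a] by blast
qed

end
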